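(* Let $(M,\Gamma,\le)$ be an ordered $\Gamma$-semigroup. The following are equivalent: (1) $M$ is strongly regular. (2) For every $a\in M$ there exist $y\in M$ and $\gamma,\mu\in\Gamma$ such that $a\le a\gamma y\mu a$, $y\le y\mu a\gamma y$ and $a\gamma y=y\gamma a=y\mu a=a\mu y$. (3) Every $\mathcal N$-class of $M$ is a strongly regular subsemigroup of $M$. (4) The left ideals and the right ideals of $M$ are semiprime, and for every left ideal $L$ and every right ideal $R$ of $M$ the set $(L\Gamma R]$ is a strongly regular subsemigroup of $M$. (5) $M$ is left regular, right regular, and the set $(M\Gamma a\Gamma M]$ is a strongly regular subsemigroup of $M$ for every $a\in M$. (6) For every $a\in M$ there exist $e_a, e'_a\in M\Gamma a\Gamma a\Gamma M$ and $\rho,\mu\in\Gamma$ such that $e_a\le e_a\rho e'_a$, $a\le e_a\mu a$, $a\le a\rho e'_a$, $(M\Gamma e_a\Gamma M]=(M\Gamma e'_a\Gamma M]=(M\Gamma a\Gamma M]$, and the set $(M\Gamma a\Gamma M]$ is a strongly regular subsemigroup of $M$. (7) For every $a\in M$ there exist $e_a,e'_a\in M$ and $\rho,\mu\in\Gamma$ such that $a\le e_a\mu a$, $a\le a\rho e'_a$, and the set $(M\Gamma a\Gamma M]$ is a strongly regular subsemigroup of $M$. (8) For every $a\in M$ we have $a\in (M\Gamma a]\cap(a\Gamma M]$, and $(M\Gamma a\Gamma M]$ is a strongly regular subsemigroup of $M$.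
   Context: A $\Gamma$-semigroup consists of two nonempty sets $M$ and $\Gamma$ together with a well-defined map $M\times\Gamma\times M\to M$, $(a,\gamma,b)\mapsto a\gamma b$, such that $(a\gamma b)\mu c=a\gamma(b\mu c)$ for all $a,b,c\in M$ and all $\gamma,\mu\in\Gamma$. An ordered $\Gamma$-semigroup $(M,\Gamma,\le)$ is a $\Gamma$-semigroup $M$ with a partial order $\le$ on $M$ such that $a\le b$ implies $a\gamma c\le b\gamma c$ and $c\gamma a\le c\gamma b$ for all $c\in M$, $\gamma\in\Gamma$. For $A,B\subseteq M$, $A\Gamma B:=\{a\gamma b\mid a\in A,\ b\in B,\ \gamma\in\Gamma\}$; in such products a single element $a$ stands for $\{a\}$, and longer products such as $M\Gamma a\Gamma a\Gamma M$ are iterated (parentheses are irrelevant by associativity). For $H\subseteq M$, $(H]:=\{t\in M\mid t\le h\text{ for some }h\in H\}$. A subsemigroup of $M$ is a nonempty subset $A$ with $A\Gamma A\subseteq A$. $M$ is strongly regular if for every $a\in M$ there exist $x\in M$ and $\gamma,\mu\in\Gamma$ such that $a\le a\gamma x\mu a$ and $a\gamma x=x\gamma a=x\mu a=a\mu x$. A subsemigroup $T$ of $M$ is strongly regular if it is so with the same $\Gamma$ and the order of $M$: for every $a\in T$ there exist $y\in T$ and $\lambda,\xi\in\Gamma$ such that $a\le a\lambda y\xi a$ and $a\lambda y=y\lambda a=y\xi a=a\xi y$. $M$ is left regular if $a\in(M\Gamma a\Gamma a]$ for every $a\in M$, and right regular if $a\in(a\Gamma a\Gamma M]$ for every $a\in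 M$. A nonempty subset $A$ of $M$ is a left (resp. right) ideal of $M$ if $M\Gamma A\subseteq A$ (resp. $A\Gamma M\subseteq A$) and, whenever $a\in A$ and $b\in M$ with $b\le a$, then $b\in A$. A subset $T$ of $M$ is semiprime if for every $A\subseteq M$, $A\Gamma A\subseteq T$ implies $A\subseteq T$ (equivalently, for every $a\in M$, $a\Gamma a\subseteq T$ implies $a\in T$). A filter of $M$ is a subsemigroup $F$ of $M$ such that (i) if $a,b\in M$, $\gamma\in\Gamma$ and $a\gamma b\in F$, then $a,b\in F$; and (ii) if $a\in F$ and $b\in M$ with $b\ge a$, then $b\in F$. For $a\in M$, $N(a)$ is the filter of $M$ generated by $a$ (the smallest filter of $M$ containing $a$). $\mathcal N$ is the equivalence relation $\mathcal N:=\{(a,b)\in M\times M\mid N(a)=N(b)\}$, and an $\mathcal N$-class is an equivalence class of $\mathcal N$. *)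

theory Defs
  imports Main
begin

record ('a, 'g) gamma_struct =
  carrier :: "'a set"
  scalars :: "'g set" ("\<Gamma>\<index>")
  gmult :: "'a \<Rightarrow> 'g \<Rightarrow> 'a \<Rightarrow> 'a" ("(_ \<cdot>_\<cdot>\<index> _)" [70, 1000, 71] 70)
  leq :: "'a \<Rightarrow> 'a \<Rightarrow> bool" (infix "\<preceq>\<index>" 50)

locale gamma_semigroup =
  fixes M :: "('a, 'g, 'm) gamma_struct_scheme" (structure)
  assumes carrier_nonempty: "carrier M \<noteq> {}"
    and scalars_nonempty: "\<Gamma> \<noteq> {}"
    and gmult_closed: "\<lbrakk>a \<in> carrier M; \<gamma> \<in> \<Gamma>; b \<in> carrier M\<rbrakk> \<Longrightarrow> a \<cdot>\<gamma>\<cdot> b \<in> carrier M"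
    and gmult_assoc: "\<lbrakk>a \<in> carrier M; b \<in> carrier M; c \<in> carrier M; \<gamma> \<in> \<Gamma>; \<mu> \<in> \<Gamma>\<rbrakk>
      \<Longrightarrow> (a \<cdot>\<gamma>\<cdot> b) \<cdot>\<mu>\<cdot> c = a \<cdot>\<gamma>\<cdot> (b \<cdot>\<mu>\<cdot> c)"

locale ordered_gamma_semigroup = gamma_semigroup +
  assumes leq_refl: "reflp_on (carrier M) (leq M)"
    and leq_antisym: "antisymp_on (carrier M) (leq M)"
    and leq_trans: "transp_on (carrier M) (leq M)"
    and leq_gmult_right: "\<lbrakk>a \<in> carrier M; b \<in> carrier M; c \<in> carrier M; \<gamma> \<in> \<Gamma>; a \<preceq> b\<rbrakk>
      \<Longrightarrow> a \<cdot>\<gamma>\<cdot> c \<preceq> b \<cdot>\<gamma>\<cdot> c"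
    and leq_gmult_left: "\<lbrakk>a \<in> carrier M; b \<in> carrier M; c \<in> carrier M; \<gamma> \<in> \<Gamma>; a \<preceq> b\<rbrakk>
      \<Longrightarrow> c \<cdot>\<gamma>\<cdot> a \<preceq> c \<cdot>\<gamma>\<cdot> b"

text \<open>The complex product \<open>A \<Gamma> B\<close>; iterated products associate to the left.\<close>

definition set_mult :: "('a, 'g, 'm) gamma_struct_scheme \<Rightarrow> 'a set \<Rightarrow> 'a set \<Rightarrow> 'a set"
    (infixl "\<odot>\<index>" 70)
  where "A \<odot>\<^bsub>M\<^esub> B = {a \<cdot>\<gamma>\<cdot>\<^bsub>M\<^esub> b | a \<gamma> b. a \<in> A \<and> \<gamma> \<in> \<Gamma>\<^bsub>M\<^esub> \<and> b \<in> B}"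

text \<open>The set \<open>(H]\<close>.\<close>

definition downset :: "('a, 'g, 'm) gamma_struct_scheme \<Rightarrow> 'a set \<Rightarrow> 'a set"
  where "downset M H = {t \<in> carrier M. \<exists>h\<in>H. t \<preceq>\<^bsub>M\<^esub> h}"

definition subsemigroup :: "('a, 'g, 'm) gamma_struct_scheme \<Rightarrow> 'a set \<Rightarrow> bool"
  where "subsemigroup M A \<longleftrightarrow> A \<noteq> {} \<and> A \<subseteq> carrier M \<and> A \<odot>\<^bsub>M\<^esub> A \<subseteq> A"

text \<open>The element \<open>x\<close> is required to lie in \<open>T\<close>; \<open>M\<close> itself is the case \<open>T = carrier M\<close>.\<close>

definition strongly_regular_on :: "('a, 'g, 'm) gamma_struct_scheme \<Rightarrow> 'a set \<Rightarrow> bool"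
  where "strongly_regular_on M T \<longleftrightarrow>
    (\<forall>a\<in>T. \<exists>x\<in>T. \<exists>\<gamma>\<in>\<Gamma>\<^bsub>M\<^esub>. \<exists>\<mu>\<in>\<Gamma>\<^bsub>M\<^esub>.
      a \<preceq>\<^bsub>M\<^esub> a \<cdot>\<gamma>\<cdot>\<^bsub>M\<^esub> x \<cdot>\<mu>\<cdot>\<^bsub>M\<^esub> a \<and>
      a \<cdot>\<gamma>\<cdot>\<^bsub>M\<^esub> x = x \<cdot>\<gamma>\<cdot>\<^bsub>M\<^esub> a \<and> x \<cdot>\<gamma>\<cdot>\<^bsub>M\<^esub> a = x \<cdot>\<mu>\<cdot>\<^bsub>M\<^esub> a \<and> x \<cdot>\<mu>\<cdot>\<^bsub>M\<^esub> a = a \<cdot>\<mu>\<cdot>\<^bsub>M\<^esub> x)"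

definition strongly_regular :: "('a, 'g, 'm) gamma_struct_scheme \<Rightarrow> bool"
  where "strongly_regular M \<longleftrightarrow> strongly_regular_on M (carrier M)"

definition strongly_regular_subsemigroup ::
    "('a, 'g, 'm) gamma_struct_scheme \<Rightarrow> 'a set \<Rightarrow> bool"
  where "strongly_regular_subsemigroup M T \<longleftrightarrow> subsemigroup M T \<and> strongly_regular_on M T"

definition left_regular :: "('a, 'g, 'm) gamma_struct_scheme \<Rightarrow> bool"
  where "left_regular M \<longleftrightarrow>
    (\<forall>a\<in>carrier M. a \<in> downset M (carrier M \<odot>\<^bsub>M\<^esub> {a} \<odot>\<^bsub>M\<^esub> {a}))"

definition right_regular :: "('a, 'g, 'm) gamma_struct_scheme \<Rightarrow> bool"
  where "right_regular M \<longleftrightarrow>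
    (\<forall>a\<in>carrier M. a \<in> downset M ({a} \<odot>\<^bsub>M\<^esub> {a} \<odot>\<^bsub>M\<^esub> carrier M))"

definition left_ideal :: "('a, 'g, 'm) gamma_struct_scheme \<Rightarrow> 'a set \<Rightarrow> bool"
  where "left_ideal M A \<longleftrightarrow> A \<noteq> {} \<and> A \<subseteq> carrier M \<and> carrier M \<odot>\<^bsub>M\<^esub> A \<subseteq> A \<and>
    (\<forall>a\<in>A. \<forall>b\<in>carrier M. b \<preceq>\<^bsub>M\<^esub> a \<longrightarrow> b \<in> A)"

definition right_ideal :: "('a, 'g, 'm) gamma_struct_scheme \<Rightarrow> 'a set \<Rightarrow> bool"
  where "right_ideal M A \<longleftrightarrow> A \<noteq> {} \<and> A \<subseteq> carrier M \<and> A \<odot>\<^bsub>M\<^esub> carrier M \<subseteq> A \<and>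
    (\<forall>a\<in>A. \<forall>b\<in>carrier M. b \<preceq>\<^bsub>M\<^esub> a \<longrightarrow> b \<in> A)"

definition semiprime :: "('a, 'g, 'm) gamma_struct_scheme \<Rightarrow> 'a set \<Rightarrow> bool"
  where "semiprime M T \<longleftrightarrow> (\<forall>A. A \<subseteq> carrier M \<longrightarrow> A \<odot>\<^bsub>M\<^esub> A \<subseteq> T \<longrightarrow> A \<subseteq> T)"

definition is_filter :: "('a, 'g, 'm) gamma_struct_scheme \<Rightarrow> 'a set \<Rightarrow> bool"
  where "is_filter M F \<longleftrightarrow> subsemigroup M F \<and>
    (\<forall>a\<in>carrier M. \<forall>b\<in>carrier M. \<forall>\<gamma>\<in>\<Gamma>\<^bsub>M\<^esub>. a \<cdot>\<gamma>\<cdot>\<^bsub>M\<^esub> b \<in> F \<longrightarrow> a \<in> F \<and> b \<in> F) \<and>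
    (\<forall>a\<in>F. \<forall>b\<in>carrier M. a \<preceq>\<^bsub>M\<^esub> b \<longrightarrow> b \<in> F)"

text \<open>For \<open>a \<in> carrier M\<close> this is the smallest filter containing \<open>a\<close>: \<open>carrier M\<close> is a filter,
  and an intersection of filters containing \<open>a\<close> is again one.\<close>

definition generated_filter :: "('a, 'g, 'm) gamma_struct_scheme \<Rightarrow> 'a \<Rightarrow> 'a set"
  where "generated_filter M a = \<Inter>{F. is_filter M F \<and> a \<in> F}"

definition filter_rel :: "('a, 'g, 'm) gamma_struct_scheme \<Rightarrow> 'a rel" ("\<N>\<index>")
  where "\<N>\<^bsub>M\<^esub> = {(a, b) \<in> carrier M \<times> carrier M. generated_filter M a = generated_filter M b}"

end

theory Submission
  imports Defs
begin

text \<open>The quasi-inverse \<open>x\<close> of \<open>a\<close> can be replaced by \<open>y = x \<mu> a \<gamma> x\<close>, which also satisfies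
  \<open>y \<le> y \<mu> a \<gamma> y\<close>. Together, \<open>a \<le> a \<gamma> y \<mu> a\<close> and \<open>y \<le> y \<mu> a \<gamma> y\<close> force \<open>y\<close> into every
  \<open>\<N>\<close>-class and every set \<open>(L\<Gamma>R]\<close> that contains \<open>a\<close>, so these inherit strong regularity.
  Conversely, (8) is the weakest of the ideal-theoretic conditions, and it puts \<open>a\<close> itself into
  the strongly regular set \<open>(M\<Gamma>a\<Gamma>M]\<close>.\<close>

section \<open>Complex products, down-sets and the relation \<open>\<N>\<close>\<close>

lemma set_multI [intro]:
  "a \<in> A \<Longrightarrow> \<gamma> \<in> \<Gamma>\<^bsub>M\<^esub> \<Longrightarrow> b \<in> B \<Longrightarrow> a \<cdot>\<gamma>\<cdot>\<^bsub>M\<^esub> b \<in> A \<odot>\<^bsub>M\<^esub> B"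
  unfolding set_mult_def by blast

lemma set_multE [elim!]:
  assumes "t \<in> A \<odot>\<^bsub>M\<^esub> B"
  obtains a \<gamma> b where "a \<in> A" "\<gamma> \<in> \<Gamma>\<^bsub>M\<^esub>" "b \<in> B" "t = a \<cdot>\<gamma>\<cdot>\<^bsub>M\<^esub> b"
  using assms unfolding set_mult_def by blast

lemma downsetI: "t \<in> carrier M \<Longrightarrow> t \<preceq>\<^bsub>M\<^esub> h \<Longrightarrow> h \<in> H \<Longrightarrow> t \<in> downset M H"
  unfolding downset_def by blast

lemma downsetE:
  assumes "t \<in> downset M H"
  obtains h where "t \<in> carrier M" "h \<in> H" "t \<preceq>\<^bsub>M\<^esub> h"
  using assms unfolding downset_def by blast

lemma downset_mono: "H \<subseteq> K \<Longrightarrow> downset M H \<subseteq> downset M K"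
  unfolding downset_def by blast

lemma strongly_regularE:
  assumes "strongly_regular_on M T" "a \<in> T"
  obtains x \<gamma> \<mu> where "x \<in> T" "\<gamma> \<in> \<Gamma>\<^bsub>M\<^esub>" "\<mu> \<in> \<Gamma>\<^bsub>M\<^esub>" "a \<preceq>\<^bsub>M\<^esub> a \<cdot>\<gamma>\<cdot>\<^bsub>M\<^esub> x \<cdot>\<mu>\<cdot>\<^bsub>M\<^esub> a"
    "a \<cdot>\<gamma>\<cdot>\<^bsub>M\<^esub> x = x \<cdot>\<gamma>\<cdot>\<^bsub>M\<^esub> a" "x \<cdot>\<gamma>\<cdot>\<^bsub>M\<^esub> a = x \<cdot>\<mu>\<cdot>\<^bsub>M\<^esub> a" "x \<cdot>\<mu>\<cdot>\<^bsub>M\<^esub> a = a \<cdot>\<mu>\<cdot>\<^bsub>M\<^esub> x"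
  using assms unfolding strongly_regular_on_def by meson

text \<open>Each element lies in the intersection that generates its filter, so equal intersections
  put \<open>a\<close> into every filter containing \<open>b\<close> and vice versa; conversely,
  equal families of filters have equal intersections. Later arguments thus test one filter at a
  time.\<close>

lemma filter_rel_iff:
  "(a, b) \<in> \<N>\<^bsub>M\<^esub> \<longleftrightarrow> a \<in> carrier M \<and> b \<in> carrier M \<and> (\<forall>F. is_filter M F \<longrightarrow> (a \<in> F \<longleftrightarrow> b \<in> F))"
proof -
  have "a \<in> generated_filter M a" "b \<in> generated_filter M b"
    unfolding generated_filter_def by auto
  moreover have "generated_filter M a = generated_filter M b"
    if "\<forall>F. is_filter M F \<longrightarrow> (a \<in> F \<longleftrightarrow> b \<in> F)"
    using that unfolding generated_filter_def by (intro arg_cong[where f = Inter]) auto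
  ultimately show ?thesis
    unfolding filter_rel_def by (auto simp: generated_filter_def)
qed

lemma equiv_filter_rel: "equiv (carrier M) \<N>\<^bsub>M\<^esub>"
  unfolding filter_rel_def equiv_def refl_on_def sym_def trans_def by auto

context ordered_gamma_semigroup
begin

section \<open>Order and monotonicity in an ordered \<Gamma>-semigroup\<close>

lemma le_refl: "a \<in> carrier M \<Longrightarrow> a \<preceq> a"
  using leq_refl by (auto dest: reflp_onD)

lemma le_trans:
  "a \<preceq> b \<Longrightarrow> b \<preceq> c \<Longrightarrow> a \<in> carrier M \<Longrightarrow> b \<in> carrier M \<Longrightarrow> c \<in> carrier M \<Longrightarrow> a \<preceq> c"
  using leq_trans by (blast dest: transp_onD)

lemma gmult_mono:
  assumes "a \<in> carrier M" "b \<in> carrier M" "c \<in> carrier M" "d \<in> carrier M" "\<gamma> \<in> \<Gamma>"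
    and "a \<preceq> b" "c \<preceq> d"
  shows "a \<cdot>\<gamma>\<cdot> c \<preceq> b \<cdot>\<gamma>\<cdot> d"
  using assms
  by (intro le_trans[OF leq_gmult_right[of a b c \<gamma>] leq_gmult_left[of c d b \<gamma>]]) (auto intro: gmult_closed)

lemma set_mult_closed: "A \<subseteq> carrier M \<Longrightarrow> B \<subseteq> carrier M \<Longrightarrow> A \<odot> B \<subseteq> carrier M"
  by (auto intro: gmult_closed)

lemma downset_trans:
  assumes "a \<in> downset M H" "H \<subseteq> carrier M" "b \<in> carrier M" "b \<preceq> a"
  shows "b \<in> downset M H"
  using assms by (meson downsetE downsetI le_trans subsetD)

section \<open>Symmetric quasi-inverses\<close>

text \<open>Let \<open>f\<close> be the common value of the four products of \<open>a\<close> and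
  \<open>x\<close>. Multiplying \<open>y = x \<mu> a \<gamma> x\<close> by \<open>a\<close> from the
  left gives \<open>f \<mu> f\<close>, from the right \<open>f \<gamma> f\<close>, whichever scalar
  is used. The commutation laws for \<open>y\<close> therefore reduce to
  \<open>f \<mu> f = f \<gamma> f\<close>.\<close>

lemma strong_inverse:
  assumes "strongly_regular M" "a \<in> carrier M"
  obtains y \<gamma> \<mu> where "y \<in> carrier M" "\<gamma> \<in> \<Gamma>" "\<mu> \<in> \<Gamma>"
    "a \<preceq> a \<cdot>\<gamma>\<cdot> y \<cdot>\<mu>\<cdot> a" "y \<preceq> y \<cdot>\<mu>\<cdot> a \<cdot>\<gamma>\<cdot> y"
    "a \<cdot>\<gamma>\<cdot> y = y \<cdot>\<gamma>\<cdot> a" "y \<cdot>\<gamma>\<cdot> a = y \<cdot>\<mu>\<cdot> a" "y \<cdot>\<mu>\<cdot> a = a \<cdot>\<mu>\<cdot> y"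
proof -
  obtain x \<gamma> \<mu> where x: "x \<in> carrier M" "\<gamma> \<in> \<Gamma>" "\<mu> \<in> \<Gamma>"
    and le: "a \<preceq> a \<cdot>\<gamma>\<cdot> x \<cdot>\<mu>\<cdot> a"
    and eqs: "a \<cdot>\<gamma>\<cdot> x = x \<cdot>\<gamma>\<cdot> a" "x \<cdot>\<gamma>\<cdot> a = x \<cdot>\<mu>\<cdot> a" "x \<cdot>\<mu>\<cdot> a = a \<cdot>\<mu>\<cdot> x"
    using assms unfolding strongly_regular_def by (rule strongly_regularE)
  note [simp] = x assms(2) gmult_closed gmult_assoc
  define f where "f = x \<cdot>\<mu>\<cdot> a"
  define y where "y = x \<cdot>\<mu>\<cdot> a \<cdot>\<gamma>\<cdot> x"
  have f: "a \<cdot>\<gamma>\<cdot> x = f" "x \<cdot>\<gamma>\<cdot> a = f" "x \<cdot>\<mu>\<cdot> a = f" "a \<cdot>\<mu>\<cdot> x = f"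
    using eqs f_def by auto
  have [simp]: "f \<in> carrier M" "y \<in> carrier M" unfolding f_def y_def by auto
  \<comment> \<open>With both factors written as \<open>a \<gamma> x\<close>, the scalar between
    them sits in an inner \<open>x \<mu> a\<close>, which equals
    \<open>x \<gamma> a\<close>.\<close>
  have "f \<cdot>\<mu>\<cdot> f = a \<cdot>\<gamma>\<cdot> (x \<cdot>\<mu>\<cdot> a) \<cdot>\<gamma>\<cdot> x" using f(1) by (metis assms(2) gmult_assoc gmult_closed x)
  also have "\<dots> = a \<cdot>\<gamma>\<cdot> (x \<cdot>\<gamma>\<cdot> a) \<cdot>\<gamma>\<cdot> x" using f by simp
  also have "\<dots> = f \<cdot>\<gamma>\<cdot> f" using f(1) by (metis assms(2) gmult_assoc gmult_closed x)
  finally have ff: "f \<cdot>\<mu>\<cdot> f = f \<cdot>\<gamma>\<cdot> f" .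
  have fa: "y = f \<cdot>\<gamma>\<cdot> x" unfolding y_def f_def ..
  have fa': "y = x \<cdot>\<mu>\<cdot> f" unfolding y_def f(1)[symmetric] by simp
  have yg: "y \<cdot>\<gamma>\<cdot> a = f \<cdot>\<gamma>\<cdot> f" using fa f(2) by simp
  have ym: "y \<cdot>\<mu>\<cdot> a = f \<cdot>\<gamma>\<cdot> f" using fa f(3) by simp
  have gy: "a \<cdot>\<gamma>\<cdot> y = f \<cdot>\<mu>\<cdot> f" using fa' f(1) by (metis assms(2) gmult_assoc x \<open>f \<in> carrier M\<close>)
  have my: "a \<cdot>\<mu>\<cdot> y = f \<cdot>\<mu>\<cdot> f" using fa' f(4) by (metis assms(2) gmult_assoc x \<open>f \<in> carrier M\<close>)
  \<comment> \<open>The hypothesis \<open>le\<close> is substituted for its own last factor; the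
    resulting upper bound of \<open>a\<close> regroups to
    \<open>a \<gamma> y \<mu> a\<close>.\<close>
  have le2: "a \<cdot>\<gamma>\<cdot> x \<cdot>\<mu>\<cdot> a \<preceq> a \<cdot>\<gamma>\<cdot> x \<cdot>\<mu>\<cdot> (a \<cdot>\<gamma>\<cdot> x \<cdot>\<mu>\<cdot> a)"
    by (intro leq_gmult_left le gmult_closed x assms(2))
  have le3: "a \<preceq> a \<cdot>\<gamma>\<cdot> y \<cdot>\<mu>\<cdot> a"
    using le_trans[OF le le2] unfolding y_def by simp
  \<comment> \<open>Sandwiching \<open>le3\<close> between copies of \<open>x\<close> gives
    \<open>y\<close> on the left, and on the right a product that regroups to
    \<open>y \<mu> a \<gamma> y\<close>.\<close>
  have "x \<cdot>\<mu>\<cdot> a \<cdot>\<gamma>\<cdot> x \<preceq> x \<cdot>\<mu>\<cdot> (a \<cdot>\<gamma>\<cdot> y \<cdot>\<mu>\<cdot> a) \<cdot>\<gamma>\<cdot> x"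
    by (intro leq_gmult_left leq_gmult_right le3) auto
  then have "y \<preceq> y \<cdot>\<mu>\<cdot> a \<cdot>\<gamma>\<cdot> y"
    unfolding y_def by simp
  then show thesis
    using that[of y \<gamma> \<mu>] le3 yg ym gy my ff by simp
qed

section \<open>Strong regularity and the \<open>\<N>\<close>-classes\<close>

text \<open>A filter contains \<open>a \<gamma> b\<close> exactly when it contains both factors.
  Within one class it contains both as soon as it contains \<open>a\<close>, so
  \<open>a \<gamma> b\<close> lies in the same filters as \<open>a\<close>.\<close>

lemma filter_class_subsemigroup:
  assumes "C \<in> carrier M // \<N>"
  shows "subsemigroup M C"
proof -
  have rel: "(a, b) \<in> \<N>" if "a \<in> C" "b \<in> C" for a b
    using quotient_eq_iff[OF equiv_filter_rel assms assms that] by simp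
  have sub: "C \<subseteq> carrier M" "C \<noteq> {}"
    using assms equiv_filter_rel in_quotient_imp_subset in_quotient_imp_non_empty by metis+
  have "a \<cdot>\<gamma>\<cdot> b \<in> C" if "a \<in> C" "b \<in> C" "\<gamma> \<in> \<Gamma>" for a b \<gamma>
  proof -
    have ab: "a \<in> carrier M" "b \<in> carrier M" using that sub by auto
    have "a \<in> F \<longleftrightarrow> a \<cdot>\<gamma>\<cdot> b \<in> F" if F: "is_filter M F" for F
    proof
      assume "a \<in> F"
      moreover from this have "b \<in> F"
        using rel[OF \<open>a \<in> C\<close> \<open>b \<in> C\<close>] F by (auto simp: filter_rel_iff)
      ultimately show "a \<cdot>\<gamma>\<cdot> b \<in> F"
        using F \<open>\<gamma> \<in> \<Gamma>\<close> unfolding is_filter_def subsemigroup_def by blast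
    next
      assume "a \<cdot>\<gamma>\<cdot> b \<in> F"
      then show "a \<in> F" using F ab \<open>\<gamma> \<in> \<Gamma>\<close> unfolding is_filter_def by blast
    qed
    then have "(a, a \<cdot>\<gamma>\<cdot> b) \<in> \<N>"
      using ab that by (auto simp: filter_rel_iff gmult_closed)
    then show ?thesis
      using in_quotient_imp_closed[OF equiv_filter_rel assms \<open>a \<in> C\<close>] by blast
  qed
  then show ?thesis using sub unfolding subsemigroup_def by auto
qed

lemma filter_class_strongly_regular:
  assumes sr: "strongly_regular M" and C: "C \<in> carrier M // \<N>"
  shows "strongly_regular_on M C"
  unfolding strongly_regular_on_def
proof
  fix a assume a: "a \<in> C"
  have aM: "a \<in> carrier M"
    using filter_class_subsemigroup[OF C] a unfolding subsemigroup_def by blast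
  obtain y \<gamma> \<mu> where y: "y \<in> carrier M" "\<gamma> \<in> \<Gamma>" "\<mu> \<in> \<Gamma>"
    and le: "a \<preceq> a \<cdot>\<gamma>\<cdot> y \<cdot>\<mu>\<cdot> a" "y \<preceq> y \<cdot>\<mu>\<cdot> a \<cdot>\<gamma>\<cdot> y"
    and eqs: "a \<cdot>\<gamma>\<cdot> y = y \<cdot>\<gamma>\<cdot> a" "y \<cdot>\<gamma>\<cdot> a = y \<cdot>\<mu>\<cdot> a" "y \<cdot>\<mu>\<cdot> a = a \<cdot>\<mu>\<cdot> y"
    using strong_inverse[OF sr aM] .
  \<comment> \<open>Upward closure puts \<open>u \<alpha> v \<beta> u\<close> into \<open>F\<close>,
    and splitting this product twice extracts \<open>v\<close>. Applied to \<open>a, y\<close> and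
    to \<open>y, a\<close>, this shows that both lie in the same filters.\<close>
  have middle: "v \<in> F"
    if F: "is_filter M F" and "u \<in> F" "u \<in> carrier M" "v \<in> carrier M" "\<alpha> \<in> \<Gamma>" "\<beta> \<in> \<Gamma>"
      and le: "u \<preceq> u \<cdot>\<alpha>\<cdot> v \<cdot>\<beta>\<cdot> u" for F u v \<alpha> \<beta>
  proof -
    have "u \<cdot>\<alpha>\<cdot> v \<in> carrier M" "u \<cdot>\<alpha>\<cdot> v \<cdot>\<beta>\<cdot> u \<in> carrier M"
      using that by (auto intro: gmult_closed)
    then show ?thesis using that unfolding is_filter_def by meson
  qed
  have "(a, y) \<in> \<N>"
    unfolding filter_rel_iff using middle y aM le by blast
  then have "y \<in> C"
    using in_quotient_imp_closed[OF equiv_filter_rel C a] by blast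
  then show "\<exists>x\<in>C. \<exists>\<gamma>\<in>\<Gamma>. \<exists>\<mu>\<in>\<Gamma>. a \<preceq> a \<cdot>\<gamma>\<cdot> x \<cdot>\<mu>\<cdot> a \<and>
      a \<cdot>\<gamma>\<cdot> x = x \<cdot>\<gamma>\<cdot> a \<and> x \<cdot>\<gamma>\<cdot> a = x \<cdot>\<mu>\<cdot> a \<and> x \<cdot>\<mu>\<cdot> a = a \<cdot>\<mu>\<cdot> x"
    using y le eqs by blast
qed

lemma strongly_regular_if_filter_classes:
  assumes "\<forall>C \<in> carrier M // \<N>. strongly_regular_subsemigroup M C"
  shows "strongly_regular M"
  unfolding strongly_regular_def strongly_regular_on_def
proof
  fix a assume a: "a \<in> carrier M"
  let ?C = "\<N> `` {a}"
  have C: "?C \<in> carrier M // \<N>" using a by (rule quotientI)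
  have aC: "a \<in> ?C" using equiv_class_self[OF equiv_filter_rel a] .
  have "?C \<subseteq> carrier M" "strongly_regular_on M ?C"
    using assms C unfolding strongly_regular_subsemigroup_def subsemigroup_def by auto
  then show "\<exists>x\<in>carrier M. \<exists>\<gamma>\<in>\<Gamma>. \<exists>\<mu>\<in>\<Gamma>. a \<preceq> a \<cdot>\<gamma>\<cdot> x \<cdot>\<mu>\<cdot> a \<and>
      a \<cdot>\<gamma>\<cdot> x = x \<cdot>\<gamma>\<cdot> a \<and> x \<cdot>\<gamma>\<cdot> a = x \<cdot>\<mu>\<cdot> a \<and> x \<cdot>\<mu>\<cdot> a = a \<cdot>\<mu>\<cdot> x"
    using aC unfolding strongly_regular_on_def by blast
qed

section \<open>Semiprime ideals and the products \<open>(L\<Gamma>R]\<close>\<close>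

text \<open>Commuting \<open>y\<close> to the front turns \<open>a \<gamma> y \<mu> a\<close> into
  \<open>y \<gamma> (a \<mu> a)\<close>, so \<open>a\<close> lies below a left multiple of an
  element of \<open>A \<odot> A\<close>.\<close>

lemma left_ideal_semiprime:
  assumes sr: "strongly_regular M" and L: "left_ideal M L"
  shows "semiprime M L"
  unfolding semiprime_def
proof (intro allI impI subsetI)
  fix A a assume A: "A \<subseteq> carrier M" "A \<odot> A \<subseteq> L" "a \<in> A"
  then have a: "a \<in> carrier M" by blast
  obtain y \<gamma> \<mu> where y: "y \<in> carrier M" "\<gamma> \<in> \<Gamma>" "\<mu> \<in> \<Gamma>"
    and "a \<preceq> a \<cdot>\<gamma>\<cdot> y \<cdot>\<mu>\<cdot> a" "a \<cdot>\<gamma>\<cdot> y = y \<cdot>\<gamma>\<cdot> a"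
    using strong_inverse[OF sr a] .
  then have "a \<preceq> y \<cdot>\<gamma>\<cdot> (a \<cdot>\<mu>\<cdot> a)" using a by (simp add: gmult_assoc)
  moreover have "a \<cdot>\<mu>\<cdot> a \<in> L" using A y by blast
  ultimately show "a \<in> L" using L a y unfolding left_ideal_def by blast
qed

text \<open>Mirror image with the other scalar: \<open>y \<mu> a = a \<mu> y\<close> moves
  \<open>y\<close> to the end, giving the bound \<open>(a \<gamma> a) \<mu> y\<close>.\<close>

lemma right_ideal_semiprime:
  assumes sr: "strongly_regular M" and R: "right_ideal M R"
  shows "semiprime M R"
  unfolding semiprime_def
proof (intro allI impI subsetI)
  fix A a assume A: "A \<subseteq> carrier M" "A \<odot> A \<subseteq> R" "a \<in> A"
  then have a: "a \<in> carrier M" by blast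
  obtain y \<gamma> \<mu> where y: "y \<in> carrier M" "\<gamma> \<in> \<Gamma>" "\<mu> \<in> \<Gamma>"
    and "a \<preceq> a \<cdot>\<gamma>\<cdot> y \<cdot>\<mu>\<cdot> a" "y \<cdot>\<mu>\<cdot> a = a \<cdot>\<mu>\<cdot> y"
    using strong_inverse[OF sr a] .
  then have "a \<preceq> (a \<cdot>\<gamma>\<cdot> a) \<cdot>\<mu>\<cdot> y" using a by (simp add: gmult_assoc)
  moreover have "a \<cdot>\<gamma>\<cdot> a \<in> R" using A y by blast
  ultimately show "a \<in> R" using R a y unfolding right_ideal_def by blast
qed

lemma ideal_product_strongly_regular:
  assumes sr: "strongly_regular M" and L: "left_ideal M L" and R: "right_ideal M R"
  shows "strongly_regular_subsemigroup M (downset M (L \<odot> R))"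
proof -
  have LM: "L \<subseteq> carrier M" "L \<noteq> {}" "\<And>m \<gamma> l. m \<in> carrier M \<Longrightarrow> \<gamma> \<in> \<Gamma> \<Longrightarrow> l \<in> L \<Longrightarrow> m \<cdot>\<gamma>\<cdot> l \<in> L"
    using L unfolding left_ideal_def by auto
  have RM: "R \<subseteq> carrier M" "R \<noteq> {}" "\<And>m \<gamma> r. m \<in> carrier M \<Longrightarrow> \<gamma> \<in> \<Gamma> \<Longrightarrow> r \<in> R \<Longrightarrow> r \<cdot>\<gamma>\<cdot> m \<in> R"
    using R unfolding right_ideal_def by auto
  have sub: "L \<odot> R \<subseteq> carrier M" using LM RM by (intro set_mult_closed)
  obtain l r \<gamma>0 where "l \<in> L" "r \<in> R" "\<gamma>0 \<in> \<Gamma>" using LM RM scalars_nonempty by blast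
  then have "l \<cdot>\<gamma>0\<cdot> r \<in> L \<odot> R" by blast
  then have ne: "downset M (L \<odot> R) \<noteq> {}"
    using sub le_refl unfolding downset_def by blast
  have closed: "a \<cdot>\<delta>\<cdot> b \<in> downset M (L \<odot> R)"
    if ab: "a \<in> downset M (L \<odot> R)" "b \<in> downset M (L \<odot> R)" and \<delta>: "\<delta> \<in> \<Gamma>" for a b \<delta>
  proof -
    obtain l \<gamma> r where l: "l \<in> L" "r \<in> R" "\<gamma> \<in> \<Gamma>" "a \<in> carrier M" "a \<preceq> l \<cdot>\<gamma>\<cdot> r"
      using ab(1) by (auto elim!: downsetE)
    obtain l' \<gamma>' r' where l': "l' \<in> L" "r' \<in> R" "\<gamma>' \<in> \<Gamma>" "b \<in> carrier M" "b \<preceq> l' \<cdot>\<gamma>'\<cdot> r'"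
      using ab(2) by (auto elim!: downsetE)
    have c: "l \<in> carrier M" "r \<in> carrier M" "l' \<in> carrier M" "r' \<in> carrier M"
      using l l' LM RM by auto
    have "a \<cdot>\<delta>\<cdot> b \<preceq> (l \<cdot>\<gamma>\<cdot> r) \<cdot>\<delta>\<cdot> (l' \<cdot>\<gamma>'\<cdot> r')"
      using l l' c \<delta> by (intro gmult_mono gmult_closed) auto
    \<comment> \<open>After regrouping, the factor behind \<open>l\<close> is a right multiple of
      \<open>r\<close> and hence stays in \<open>R\<close>.\<close>
    also have "(l \<cdot>\<gamma>\<cdot> r) \<cdot>\<delta>\<cdot> (l' \<cdot>\<gamma>'\<cdot> r') = l \<cdot>\<gamma>\<cdot> (r \<cdot>\<delta>\<cdot> (l' \<cdot>\<gamma>'\<cdot> r'))"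
      using l l' c \<delta> by (simp add: gmult_assoc gmult_closed)
    finally show ?thesis
      by (rule downsetI[rotated]) (use l l' c ab \<delta> in \<open>auto intro!: set_multI RM(3) gmult_closed\<close>)
  qed
  have "strongly_regular_on M (downset M (L \<odot> R))"
    unfolding strongly_regular_on_def
  proof
    fix a assume "a \<in> downset M (L \<odot> R)"
    then obtain l \<delta> r where l: "l \<in> L" "r \<in> R" "\<delta> \<in> \<Gamma>" and a: "a \<in> carrier M" "a \<preceq> l \<cdot>\<delta>\<cdot> r"
      by (auto elim!: downsetE)
    have c: "l \<in> carrier M" "r \<in> carrier M" using l LM RM by auto
    obtain y \<gamma> \<mu> where y: "y \<in> carrier M" "\<gamma> \<in> \<Gamma>" "\<mu> \<in> \<Gamma>"
      and le: "a \<preceq> a \<cdot>\<gamma>\<cdot> y \<cdot>\<mu>\<cdot> a" "y \<preceq> y \<cdot>\<mu>\<cdot> a \<cdot>\<gamma>\<cdot> y"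
      and eqs: "a \<cdot>\<gamma>\<cdot> y = y \<cdot>\<gamma>\<cdot> a" "y \<cdot>\<gamma>\<cdot> a = y \<cdot>\<mu>\<cdot> a" "y \<cdot>\<mu>\<cdot> a = a \<cdot>\<mu>\<cdot> y"
      using strong_inverse[OF sr a(1)] .
    \<comment> \<open>Only membership of \<open>y\<close> in \<open>(L\<Gamma>R]\<close> remains to
      be shown. Replacing \<open>a\<close> by its bound in
      \<open>y \<le> y \<mu> a \<gamma> y\<close> leaves one \<open>y\<close> on each side, absorbed
      by \<open>l\<close> in the left ideal and by \<open>r\<close> in the right ideal.\<close>
    have "y \<cdot>\<mu>\<cdot> a \<cdot>\<gamma>\<cdot> y \<preceq> y \<cdot>\<mu>\<cdot> (l \<cdot>\<delta>\<cdot> r) \<cdot>\<gamma>\<cdot> y"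
      using y a l c by (intro leq_gmult_left leq_gmult_right gmult_closed)
    then have "y \<preceq> y \<cdot>\<mu>\<cdot> (l \<cdot>\<delta>\<cdot> r) \<cdot>\<gamma>\<cdot> y"
      using le_trans[OF le(2)] y a l c by (simp add: gmult_closed)
    also have "y \<cdot>\<mu>\<cdot> (l \<cdot>\<delta>\<cdot> r) \<cdot>\<gamma>\<cdot> y = (y \<cdot>\<mu>\<cdot> l) \<cdot>\<delta>\<cdot> (r \<cdot>\<gamma>\<cdot> y)"
      using y l c by (simp add: gmult_assoc gmult_closed)
    finally have "y \<in> downset M (L \<odot> R)"
      by (rule downsetI[rotated]) (use y l LM RM in auto)
    then show "\<exists>x\<in>downset M (L \<odot> R). \<exists>\<gamma>\<in>\<Gamma>. \<exists>\<mu>\<in>\<Gamma>. a \<preceq> a \<cdot>\<gamma>\<cdot> x \<cdot>\<mu>\<cdot> a \<and>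
        a \<cdot>\<gamma>\<cdot> x = x \<cdot>\<gamma>\<cdot> a \<and> x \<cdot>\<gamma>\<cdot> a = x \<cdot>\<mu>\<cdot> a \<and> x \<cdot>\<mu>\<cdot> a = a \<cdot>\<mu>\<cdot> x"
      using y le eqs by blast
  qed
  moreover have "downset M (L \<odot> R) \<subseteq> carrier M" unfolding downset_def by blast
  ultimately show ?thesis
    using ne closed unfolding strongly_regular_subsemigroup_def subsemigroup_def by blast
qed

section \<open>Ideals built as down-sets of complex products\<close>

text \<open>If \<open>t \<le> h\<close> with \<open>h\<close> in \<open>A\<close>, monotonicity puts
  \<open>m \<gamma> t\<close> below \<open>m \<gamma> h\<close>, which \<open>A\<close>
  absorbs.\<close>

lemma left_ideal_downset:
  assumes "A \<noteq> {}" "A \<subseteq> carrier M" "carrier M \<odot> A \<subseteq> A"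
  shows "left_ideal M (downset M A)"
proof -
  have "m \<cdot>\<gamma>\<cdot> t \<in> downset M A" if m: "m \<in> carrier M" "\<gamma> \<in> \<Gamma>" "t \<in> downset M A" for m \<gamma> t
  proof -
    obtain h where h: "t \<in> carrier M" "h \<in> A" "t \<preceq> h" using m(3) by (rule downsetE)
    have "m \<cdot>\<gamma>\<cdot> t \<preceq> m \<cdot>\<gamma>\<cdot> h" using m h assms by (intro leq_gmult_left) auto
    moreover have "m \<cdot>\<gamma>\<cdot> h \<in> A" using m h assms by blast
    ultimately show ?thesis using m h by (intro downsetI gmult_closed)
  qed
  moreover have "A \<subseteq> downset M A" using assms(2) le_refl by (auto intro: downsetI)
  ultimately show ?thesis
    using assms(1) downset_trans[OF _ assms(2)] unfolding left_ideal_def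
    by (auto elim: downsetE)
qed

lemma right_ideal_downset:
  assumes "A \<noteq> {}" "A \<subseteq> carrier M" "A \<odot> carrier M \<subseteq> A"
  shows "right_ideal M (downset M A)"
proof -
  have "t \<cdot>\<gamma>\<cdot> m \<in> downset M A" if m: "m \<in> carrier M" "\<gamma> \<in> \<Gamma>" "t \<in> downset M A" for m \<gamma> t
  proof -
    obtain h where h: "t \<in> carrier M" "h \<in> A" "t \<preceq> h" using m(3) by (rule downsetE)
    have "t \<cdot>\<gamma>\<cdot> m \<preceq> h \<cdot>\<gamma>\<cdot> m" using m h assms by (intro leq_gmult_right) auto
    moreover have "h \<cdot>\<gamma>\<cdot> m \<in> A" using m h assms by blast
    ultimately show ?thesis using m h by (intro downsetI gmult_closed)
  qed
  moreover have "A \<subseteq> downset M A" using assms(2) le_refl by (auto intro: downsetI)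
  ultimately show ?thesis
    using assms(1) downset_trans[OF _ assms(2)] unfolding right_ideal_def
    by (auto elim: downsetE)
qed

lemma set_mult_nonempty: "A \<noteq> {} \<Longrightarrow> B \<noteq> {} \<Longrightarrow> A \<odot> B \<noteq> {}"
  using scalars_nonempty by blast

lemma set_mult_assoc:
  assumes "A \<subseteq> carrier M" "B \<subseteq> carrier M" "C \<subseteq> carrier M"
  shows "A \<odot> B \<odot> C = A \<odot> (B \<odot> C)"
proof
  show "A \<odot> B \<odot> C \<subseteq> A \<odot> (B \<odot> C)"
  proof
    fix t assume "t \<in> A \<odot> B \<odot> C"
    then obtain a \<gamma> b \<mu> c where *: "a \<in> A" "b \<in> B" "c \<in> C" "\<gamma> \<in> \<Gamma>" "\<mu> \<in> \<Gamma>"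
      and "t = a \<cdot>\<gamma>\<cdot> b \<cdot>\<mu>\<cdot> c" by blast
    then have "t = a \<cdot>\<gamma>\<cdot> (b \<cdot>\<mu>\<cdot> c)" using assms by (simp add: gmult_assoc subset_iff)
    with * show "t \<in> A \<odot> (B \<odot> C)" by blast
  qed
  show "A \<odot> (B \<odot> C) \<subseteq> A \<odot> B \<odot> C"
  proof
    fix t assume "t \<in> A \<odot> (B \<odot> C)"
    then obtain a \<gamma> b \<mu> c where *: "a \<in> A" "b \<in> B" "c \<in> C" "\<gamma> \<in> \<Gamma>" "\<mu> \<in> \<Gamma>"
      and "t = a \<cdot>\<gamma>\<cdot> (b \<cdot>\<mu>\<cdot> c)" by blast
    then have "t = a \<cdot>\<gamma>\<cdot> b \<cdot>\<mu>\<cdot> c" using assms by (simp add: gmult_assoc subset_iff)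
    with * show "t \<in> A \<odot> B \<odot> C" by blast
  qed
qed

lemma set_mult_mono: "A \<subseteq> A' \<Longrightarrow> B \<subseteq> B' \<Longrightarrow> A \<odot> B \<subseteq> A' \<odot> B'"
  by blast

text \<open>Two factors \<open>carrier M\<close> in front merge into one. The case
  \<open>A = {a}\<close> gives \<open>(M\<Gamma>a]\<close>, and \<open>A = {a} \<odot> {a}\<close>
  gives the set occurring in left regularity.\<close>

lemma left_ideal_left_multiples:
  assumes "A \<noteq> {}" "A \<subseteq> carrier M"
  shows "left_ideal M (downset M (carrier M \<odot> A))"
proof (rule left_ideal_downset)
  have "carrier M \<odot> (carrier M \<odot> A) = carrier M \<odot> carrier M \<odot> A"
    using assms by (intro set_mult_assoc[symmetric]) auto
  also have "\<dots> \<subseteq> carrier M \<odot> A"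
    by (intro set_mult_mono set_mult_closed) auto
  finally show "carrier M \<odot> (carrier M \<odot> A) \<subseteq> carrier M \<odot> A" .
qed (use assms carrier_nonempty in \<open>simp_all add: set_mult_nonempty set_mult_closed\<close>)

lemma right_ideal_right_multiples:
  assumes "A \<noteq> {}" "A \<subseteq> carrier M"
  shows "right_ideal M (downset M (A \<odot> carrier M))"
proof (rule right_ideal_downset)
  have "A \<odot> carrier M \<odot> carrier M = A \<odot> (carrier M \<odot> carrier M)"
    using assms by (intro set_mult_assoc) auto
  also have "\<dots> \<subseteq> A \<odot> carrier M"
    by (intro set_mult_mono set_mult_closed) auto
  finally show "A \<odot> carrier M \<odot> carrier M \<subseteq> A \<odot> carrier M" .
qed (use assms carrier_nonempty in \<open>simp_all add: set_mult_nonempty set_mult_closed\<close>)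

lemma right_ideal_carrier: "right_ideal M (carrier M)"
  using carrier_nonempty unfolding right_ideal_def by (auto intro: gmult_closed)

text \<open>This identifies \<open>((M\<Gamma>a]\<Gamma>M]\<close> with
  \<open>(M\<Gamma>a\<Gamma>M]\<close>, so that the latter is of the form
  \<open>(L\<Gamma>R]\<close>. Taking the inner down-set adds nothing because right multiplication
  is monotone.\<close>

lemma downset_mult_downset:
  assumes "A \<subseteq> carrier M" "B \<subseteq> carrier M"
  shows "downset M (downset M A \<odot> B) = downset M (A \<odot> B)"
proof
  show "downset M (downset M A \<odot> B) \<subseteq> downset M (A \<odot> B)"
  proof
    fix t assume "t \<in> downset M (downset M A \<odot> B)"
    then obtain s \<gamma> b where t: "t \<in> carrier M" "t \<preceq> s \<cdot>\<gamma>\<cdot> b" "s \<in> downset M A" "b \<in> B" "\<gamma> \<in> \<Gamma>"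
      by (blast elim: downsetE)
    obtain h where h: "s \<in> carrier M" "h \<in> A" "s \<preceq> h" using t(3) by (rule downsetE)
    have "s \<cdot>\<gamma>\<cdot> b \<preceq> h \<cdot>\<gamma>\<cdot> b" using t h assms by (intro leq_gmult_right) auto
    then have "s \<cdot>\<gamma>\<cdot> b \<in> downset M (A \<odot> B)"
      using t h assms by (intro downsetI[where h = "h \<cdot>\<gamma>\<cdot> b"] gmult_closed) auto
    then show "t \<in> downset M (A \<odot> B)"
      by (rule downset_trans) (use t assms in \<open>simp_all add: set_mult_closed\<close>)
  qed
  have "A \<subseteq> downset M A" using assms(1) le_refl by (auto intro: downsetI)
  then show "downset M (A \<odot> B) \<subseteq> downset M (downset M A \<odot> B)"
    by (intro downset_mono set_mult_mono subset_refl)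
qed

section \<open>From semiprime ideals to left and right regularity\<close>

text \<open>Semiprimeness of the left ideal \<open>?L\<close> is used twice. Every product of
  \<open>a \<gamma> a\<close> with itself lies in \<open>?L\<close>, so \<open>a \<gamma> a\<close>
  does, for every \<open>\<gamma>\<close>; then \<open>{a} \<odot> {a}\<close> is contained in
  \<open>?L\<close>, so \<open>a\<close> is in it.\<close>

lemma left_regular_if_semiprime:
  assumes "\<forall>L. left_ideal M L \<longrightarrow> semiprime M L"
  shows "left_regular M"
  unfolding left_regular_def
proof
  fix a assume a: "a \<in> carrier M"
  let ?L = "downset M (carrier M \<odot> {a} \<odot> {a})"
  \<comment> \<open>The ideal property comes with the product nested to the right; associativity
    converts it to the nesting of \<open>?L\<close>.\<close>
  have "left_ideal M (downset M (carrier M \<odot> ({a} \<odot> {a})))"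
    using a by (intro left_ideal_left_multiples set_mult_nonempty set_mult_closed) auto
  then have sp: "semiprime M ?L"
    using assms a set_mult_assoc[of "carrier M" "{a}" "{a}"] by simp
  have "{a \<cdot>\<gamma>\<cdot> a} \<subseteq> ?L" if \<gamma>: "\<gamma> \<in> \<Gamma>" for \<gamma>
  proof -
    have "(a \<cdot>\<gamma>\<cdot> a) \<cdot>\<delta>\<cdot> (a \<cdot>\<gamma>\<cdot> a) \<in> ?L" if \<delta>: "\<delta> \<in> \<Gamma>" for \<delta>
    proof -
      \<comment> \<open>The first three factors are read as one element of \<open>M\<close> times
        \<open>a\<close>, leaving the last \<open>a\<close> as the second singleton.\<close>
      have "(a \<cdot>\<gamma>\<cdot> a) \<cdot>\<delta>\<cdot> (a \<cdot>\<gamma>\<cdot> a) = (a \<cdot>\<gamma>\<cdot> a) \<cdot>\<delta>\<cdot> a \<cdot>\<gamma>\<cdot> a"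
        using a \<gamma> \<delta> by (simp add: gmult_assoc gmult_closed)
      also have "\<dots> \<in> carrier M \<odot> {a} \<odot> {a}"
        using a \<gamma> \<delta> by (auto intro!: set_multI gmult_closed)
      finally show ?thesis
        using a \<gamma> \<delta> by (intro downsetI[OF _ le_refl]) (auto intro: gmult_closed)
    qed
    then have "{a \<cdot>\<gamma>\<cdot> a} \<odot> {a \<cdot>\<gamma>\<cdot> a} \<subseteq> ?L" by auto
    moreover have "{a \<cdot>\<gamma>\<cdot> a} \<subseteq> carrier M" using a \<gamma> gmult_closed by simp
    ultimately show ?thesis using sp unfolding semiprime_def by blast
  qed
  then have "{a} \<odot> {a} \<subseteq> ?L" by auto
  moreover have "{a} \<subseteq> carrier M" using a by simp
  ultimately have "{a} \<subseteq> ?L" using sp unfolding semiprime_def by blast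
  then show "a \<in> ?L" by simp
qed

text \<open>The same double descent. Here the nesting to the left already exhibits \<open>?R\<close>
  as the right multiples of \<open>{a} \<odot> {a}\<close>, and the second
  \<open>a \<gamma> a\<close> serves as the element of \<open>M\<close>.\<close>

lemma right_regular_if_semiprime:
  assumes "\<forall>R. right_ideal M R \<longrightarrow> semiprime M R"
  shows "right_regular M"
  unfolding right_regular_def
proof
  fix a assume a: "a \<in> carrier M"
  let ?R = "downset M ({a} \<odot> {a} \<odot> carrier M)"
  have "right_ideal M ?R"
    using a by (intro right_ideal_right_multiples set_mult_nonempty set_mult_closed) auto
  then have sp: "semiprime M ?R" using assms by simp
  have "{a \<cdot>\<gamma>\<cdot> a} \<subseteq> ?R" if \<gamma>: "\<gamma> \<in> \<Gamma>" for \<gamma>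
  proof -
    have "(a \<cdot>\<gamma>\<cdot> a) \<cdot>\<delta>\<cdot> (a \<cdot>\<gamma>\<cdot> a) \<in> ?R" if \<delta>: "\<delta> \<in> \<Gamma>" for \<delta>
      using a \<gamma> \<delta> by (intro downsetI[OF _ le_refl]) (auto intro!: gmult_closed)
    then have "{a \<cdot>\<gamma>\<cdot> a} \<odot> {a \<cdot>\<gamma>\<cdot> a} \<subseteq> ?R" by auto
    moreover have "{a \<cdot>\<gamma>\<cdot> a} \<subseteq> carrier M" using a \<gamma> gmult_closed by simp
    ultimately show ?thesis using sp unfolding semiprime_def by blast
  qed
  then have "{a} \<odot> {a} \<subseteq> ?R" by auto
  moreover have "{a} \<subseteq> carrier M" using a by simp
  ultimately have "{a} \<subseteq> ?R" using sp unfolding semiprime_def by blast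
  then show "a \<in> ?R" by simp
qed

section \<open>The principal sets \<open>(M\<Gamma>a\<Gamma>M]\<close>\<close>

text \<open>The hypothesis is applied to the left ideal \<open>(M\<Gamma>a]\<close> and to
  \<open>M\<close> itself as right ideal.\<close>

lemma principal_strongly_regular_if_products:
  assumes "\<forall>L R. left_ideal M L \<and> right_ideal M R \<longrightarrow>
      strongly_regular_subsemigroup M (downset M (L \<odot> R))"
    and a: "a \<in> carrier M"
  shows "strongly_regular_subsemigroup M (downset M (carrier M \<odot> {a} \<odot> carrier M))"
proof -
  have "strongly_regular_subsemigroup M (downset M (downset M (carrier M \<odot> {a}) \<odot> carrier M))"
    using assms by (intro assms(1)[rule_format] conjI left_ideal_left_multiples right_ideal_carrier) auto
  also have "downset M (downset M (carrier M \<odot> {a}) \<odot> carrier M)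
      = downset M (carrier M \<odot> {a} \<odot> carrier M)"
    using a by (intro downset_mult_downset set_mult_closed) auto
  finally show ?thesis .
qed

lemma principal_strongly_regular:
  assumes "strongly_regular M" "a \<in> carrier M"
  shows "strongly_regular_subsemigroup M (downset M (carrier M \<odot> {a} \<odot> carrier M))"
  using assms ideal_product_strongly_regular principal_strongly_regular_if_products by blast

text \<open>The two one-sided memberships combine: \<open>a\<close> lies below some
  \<open>a \<delta> m\<close>, and its first factor is itself in \<open>(M\<Gamma>a]\<close>. So
  \<open>a\<close> belongs to \<open>?I\<close>, whose strong regularity supplies the
  witness.\<close>

lemma strongly_regular_if_principal:
  assumes "\<And>a. a \<in> carrier M \<Longrightarrow>
      a \<in> downset M (carrier M \<odot> {a}) \<inter> downset M ({a} \<odot> carrier M) \<and>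
      strongly_regular_subsemigroup M (downset M (carrier M \<odot> {a} \<odot> carrier M))"
  shows "strongly_regular M"
  unfolding strongly_regular_def strongly_regular_on_def
proof
  fix a assume a: "a \<in> carrier M"
  let ?I = "downset M (carrier M \<odot> {a} \<odot> carrier M)"
  have "a \<in> downset M ({a} \<odot> carrier M)" "a \<in> downset M (carrier M \<odot> {a})"
    using assms[OF a] by auto
  then have "a \<in> downset M (downset M (carrier M \<odot> {a}) \<odot> carrier M)"
    using downset_mono[OF set_mult_mono, of "{a}" "downset M (carrier M \<odot> {a})" "carrier M" "carrier M"]
    by blast
  also have "\<dots> = ?I"
    using a by (intro downset_mult_downset set_mult_closed) auto
  finally have "a \<in> ?I" .
  moreover have "?I \<subseteq> carrier M" "strongly_regular_on M ?I"
    using assms[OF a] unfolding strongly_regular_subsemigroup_def subsemigroup_def by auto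
  ultimately show "\<exists>x\<in>carrier M. \<exists>\<gamma>\<in>\<Gamma>. \<exists>\<mu>\<in>\<Gamma>. a \<preceq> a \<cdot>\<gamma>\<cdot> x \<cdot>\<mu>\<cdot> a \<and>
      a \<cdot>\<gamma>\<cdot> x = x \<cdot>\<gamma>\<cdot> a \<and> x \<cdot>\<gamma>\<cdot> a = x \<cdot>\<mu>\<cdot> a \<and> x \<cdot>\<mu>\<cdot> a = a \<cdot>\<mu>\<cdot> x"
    unfolding strongly_regular_on_def by blast
qed

lemma left_regular_mem:
  assumes "left_regular M" "a \<in> carrier M"
  shows "a \<in> downset M (carrier M \<odot> {a})"
proof -
  have "carrier M \<odot> {a} \<odot> {a} \<subseteq> carrier M \<odot> {a}"
    using assms by (intro set_mult_mono set_mult_closed) auto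
  then show ?thesis
    using assms downset_mono unfolding left_regular_def by blast
qed

lemma right_regular_mem:
  assumes "right_regular M" "a \<in> carrier M"
  shows "a \<in> downset M ({a} \<odot> carrier M)"
proof -
  have "{a} \<odot> {a} \<odot> carrier M = {a} \<odot> ({a} \<odot> carrier M)"
    using assms by (intro set_mult_assoc) auto
  also have "\<dots> \<subseteq> {a} \<odot> carrier M"
    using assms by (intro set_mult_mono set_mult_closed) auto
  finally show ?thesis
    using assms downset_mono unfolding right_regular_def by blast
qed

section \<open>Units for \<open>a\<close> and comparison of principal sets\<close>

text \<open>In a bound \<open>m \<alpha> a \<beta> n\<close>, the factor \<open>a\<close> may be
  replaced by \<open>b \<gamma> c\<close>, after which \<open>c\<close> is absorbed into the right
  factor from \<open>M\<close>.\<close>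

lemma downset_set_mult_triple_subset:
  assumes ab: "a \<in> carrier M" "b \<in> carrier M" "c \<in> carrier M" and \<gamma>: "\<gamma> \<in> \<Gamma>"
    and le: "a \<preceq> b \<cdot>\<gamma>\<cdot> c"
  shows "downset M (carrier M \<odot> {a} \<odot> carrier M) \<subseteq> downset M (carrier M \<odot> {b} \<odot> carrier M)"
proof
  fix t assume "t \<in> downset M (carrier M \<odot> {a} \<odot> carrier M)"
  then obtain m \<alpha> \<beta> n where t: "m \<in> carrier M" "\<alpha> \<in> \<Gamma>" "\<beta> \<in> \<Gamma>" "n \<in> carrier M" "t \<in> carrier M"
    "t \<preceq> m \<cdot>\<alpha>\<cdot> a \<cdot>\<beta>\<cdot> n"
    by (auto elim!: downsetE)
  have "m \<cdot>\<alpha>\<cdot> a \<cdot>\<beta>\<cdot> n \<preceq> m \<cdot>\<alpha>\<cdot> (b \<cdot>\<gamma>\<cdot> c) \<cdot>\<beta>\<cdot> n"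
    using t assms by (intro leq_gmult_left leq_gmult_right gmult_closed)
  with t(6) have "t \<preceq> m \<cdot>\<alpha>\<cdot> (b \<cdot>\<gamma>\<cdot> c) \<cdot>\<beta>\<cdot> n"
    by (rule le_trans) (use t assms in \<open>simp_all add: gmult_closed\<close>)
  also have "m \<cdot>\<alpha>\<cdot> (b \<cdot>\<gamma>\<cdot> c) \<cdot>\<beta>\<cdot> n = m \<cdot>\<alpha>\<cdot> b \<cdot>\<gamma>\<cdot> (c \<cdot>\<beta>\<cdot> n)"
    using t assms by (simp add: gmult_assoc gmult_closed)
  finally show "t \<in> downset M (carrier M \<odot> {b} \<odot> carrier M)"
    by (rule downsetI[rotated]) (use t assms in \<open>auto intro!: set_multI gmult_closed\<close>)
qed

text \<open>The single element \<open>e = (a \<gamma> y) \<mu> (a \<gamma> y)\<close> serves as both \<open>e\<^sub>a\<close> and \<open>e'\<^sub>a\<close>.\<close>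

lemma two_sided_unit:
  assumes sr: "strongly_regular M" and a: "a \<in> carrier M"
  obtains e \<rho> \<mu> where "e \<in> carrier M \<odot> {a} \<odot> {a} \<odot> carrier M" "\<rho> \<in> \<Gamma>" "\<mu> \<in> \<Gamma>"
    "e \<preceq> e \<cdot>\<rho>\<cdot> e" "a \<preceq> e \<cdot>\<mu>\<cdot> a" "a \<preceq> a \<cdot>\<rho>\<cdot> e"
    "downset M (carrier M \<odot> {e} \<odot> carrier M) = downset M (carrier M \<odot> {a} \<odot> carrier M)"
proof -
  obtain y \<gamma> \<mu> where y: "y \<in> carrier M" "\<gamma> \<in> \<Gamma>" "\<mu> \<in> \<Gamma>"
    and le: "a \<preceq> a \<cdot>\<gamma>\<cdot> y \<cdot>\<mu>\<cdot> a"
    and eqs: "a \<cdot>\<gamma>\<cdot> y = y \<cdot>\<gamma>\<cdot> a" "y \<cdot>\<gamma>\<cdot> a = y \<cdot>\<mu>\<cdot> a" "y \<cdot>\<mu>\<cdot> a = a \<cdot>\<mu>\<cdot> y"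
    using strong_inverse[OF sr a] .
  note [simp] = y a gmult_closed gmult_assoc
  define e where "e = a \<cdot>\<gamma>\<cdot> y \<cdot>\<mu>\<cdot> a \<cdot>\<gamma>\<cdot> y"
  have [simp]: "e \<in> carrier M" unfolding e_def by simp
  \<comment> \<open>Commuting only the first \<open>a \<gamma> y\<close> brings the two copies of
    \<open>a\<close> next to each other, as membership requires.\<close>
  have "e = y \<cdot>\<gamma>\<cdot> a \<cdot>\<mu>\<cdot> a \<cdot>\<gamma>\<cdot> y" unfolding e_def eqs(1) ..
  moreover have "y \<cdot>\<gamma>\<cdot> a \<cdot>\<mu>\<cdot> a \<cdot>\<gamma>\<cdot> y \<in> carrier M \<odot> {a} \<odot> {a} \<odot> carrier M"
    by (intro set_multI y singletonI)
  ultimately have mem: "e \<in> carrier M \<odot> {a} \<odot> {a} \<odot> carrier M" by (rule ssubst)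
  \<comment> \<open>For the inequalities with \<open>e\<close> on the right, \<open>e\<close> is
    rewritten to end in \<open>\<mu> a\<close>: then \<open>e2\<close> turns
    \<open>a \<gamma> e\<close> into the upper bound in \<open>le2\<close>.\<close>
  have e1: "e = y \<cdot>\<gamma>\<cdot> a \<cdot>\<gamma>\<cdot> y \<cdot>\<mu>\<cdot> a"
  proof -
    have "e = a \<cdot>\<gamma>\<cdot> (y \<cdot>\<mu>\<cdot> a) \<cdot>\<gamma>\<cdot> y" unfolding e_def by simp
    also have "\<dots> = a \<cdot>\<gamma>\<cdot> (y \<cdot>\<gamma>\<cdot> a) \<cdot>\<gamma>\<cdot> y" using eqs by simp
    also have "\<dots> = (a \<cdot>\<gamma>\<cdot> y) \<cdot>\<gamma>\<cdot> (a \<cdot>\<gamma>\<cdot> y)" by simp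
    also have "\<dots> = (y \<cdot>\<gamma>\<cdot> a) \<cdot>\<gamma>\<cdot> (y \<cdot>\<mu>\<cdot> a)" unfolding eqs(1,2) ..
    finally show ?thesis by simp
  qed
  have e2: "e = y \<cdot>\<mu>\<cdot> a \<cdot>\<gamma>\<cdot> y \<cdot>\<mu>\<cdot> a" using e1 eqs(2) by simp
  have "a \<cdot>\<gamma>\<cdot> y \<cdot>\<mu>\<cdot> a \<preceq> a \<cdot>\<gamma>\<cdot> y \<cdot>\<mu>\<cdot> (a \<cdot>\<gamma>\<cdot> y \<cdot>\<mu>\<cdot> a)"
    by (intro leq_gmult_left le) auto
  then have le2: "a \<preceq> a \<cdot>\<gamma>\<cdot> y \<cdot>\<mu>\<cdot> (a \<cdot>\<gamma>\<cdot> y \<cdot>\<mu>\<cdot> a)"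
    using le_trans[OF le] by simp
  then have left: "a \<preceq> e \<cdot>\<mu>\<cdot> a" unfolding e_def by simp
  have right: "a \<preceq> a \<cdot>\<gamma>\<cdot> e" using le2 unfolding e2 by simp
  \<comment> \<open>The final \<open>a\<close> in the form \<open>e1\<close> is enlarged to
    \<open>a \<gamma> e\<close> by \<open>right\<close>, which yields
    \<open>e \<le> e \<gamma> e\<close>.\<close>
  have "y \<cdot>\<gamma>\<cdot> a \<cdot>\<gamma>\<cdot> y \<cdot>\<mu>\<cdot> a \<preceq> y \<cdot>\<gamma>\<cdot> a \<cdot>\<gamma>\<cdot> y \<cdot>\<mu>\<cdot> (a \<cdot>\<gamma>\<cdot> e)"
    by (intro leq_gmult_left right) auto
  then have "e \<preceq> (y \<cdot>\<gamma>\<cdot> a \<cdot>\<gamma>\<cdot> y \<cdot>\<mu>\<cdot> a) \<cdot>\<gamma>\<cdot> e" using e1 by simp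
  then have idem: "e \<preceq> e \<cdot>\<gamma>\<cdot> e" using e1 by simp
  \<comment> \<open>This bound, in fact an equality, makes the principal set of \<open>e\<close>
    part of that of \<open>a\<close>; \<open>left\<close> gives the reverse inclusion.\<close>
  have "e \<preceq> a \<cdot>\<gamma>\<cdot> (y \<cdot>\<mu>\<cdot> a \<cdot>\<gamma>\<cdot> y)" using le_refl[of e] unfolding e_def by simp
  then have "downset M (carrier M \<odot> {e} \<odot> carrier M) = downset M (carrier M \<odot> {a} \<odot> carrier M)"
    using left by (intro equalityI downset_set_mult_triple_subset) auto
  then show thesis
    using that mem y idem left right by blast
qed

end

section \<open>Cycles of implications through strong regularity\<close>

theorem mainTheorem1:
  fixes M :: "('a, 'g, 'm) gamma_struct_scheme" (structure)
  assumes "ordered_gamma_semigroup M"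
  shows
    "(strongly_regular M \<longleftrightarrow>
       (\<forall>a\<in>carrier M. \<exists>y\<in>carrier M. \<exists>\<gamma>\<in>\<Gamma>. \<exists>\<mu>\<in>\<Gamma>.
          a \<preceq> a \<cdot>\<gamma>\<cdot> y \<cdot>\<mu>\<cdot> a \<and> y \<preceq> y \<cdot>\<mu>\<cdot> a \<cdot>\<gamma>\<cdot> y \<and>
          a \<cdot>\<gamma>\<cdot> y = y \<cdot>\<gamma>\<cdot> a \<and> y \<cdot>\<gamma>\<cdot> a = y \<cdot>\<mu>\<cdot> a \<and> y \<cdot>\<mu>\<cdot> a = a \<cdot>\<mu>\<cdot> y))
   \<and> (strongly_regular M \<longleftrightarrow>
       (\<forall>C \<in> carrier M // \<N>. strongly_regular_subsemigroup M C))
   \<and> (strongly_regular M \<longleftrightarrow>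
       (\<forall>L. left_ideal M L \<longrightarrow> semiprime M L) \<and>
       (\<forall>R. right_ideal M R \<longrightarrow> semiprime M R) \<and>
       (\<forall>L R. left_ideal M L \<and> right_ideal M R \<longrightarrow>
          strongly_regular_subsemigroup M (downset M (L \<odot> R))))
   \<and> (strongly_regular M \<longleftrightarrow>
       left_regular M \<and> right_regular M \<and>
       (\<forall>a\<in>carrier M.
          strongly_regular_subsemigroup M (downset M (carrier M \<odot> {a} \<odot> carrier M))))
   \<and> (strongly_regular M \<longleftrightarrow>
       (\<forall>a\<in>carrier M.
          \<exists>e \<in> carrier M \<odot> {a} \<odot> {a} \<odot> carrier M.
          \<exists>e' \<in> carrier M \<odot> {a} \<odot> {a} \<odot> carrier M.
          \<exists>\<rho>\<in>\<Gamma>. \<exists>\<mu>\<in>\<Gamma>.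
            e \<preceq> e \<cdot>\<rho>\<cdot> e' \<and> a \<preceq> e \<cdot>\<mu>\<cdot> a \<and> a \<preceq> a \<cdot>\<rho>\<cdot> e' \<and>
            downset M (carrier M \<odot> {e} \<odot> carrier M) = downset M (carrier M \<odot> {e'} \<odot> carrier M) \<and>
            downset M (carrier M \<odot> {e'} \<odot> carrier M) = downset M (carrier M \<odot> {a} \<odot> carrier M) \<and>
            strongly_regular_subsemigroup M (downset M (carrier M \<odot> {a} \<odot> carrier M))))
   \<and> (strongly_regular M \<longleftrightarrow>
       (\<forall>a\<in>carrier M. \<exists>e\<in>carrier M. \<exists>e'\<in>carrier M. \<exists>\<rho>\<in>\<Gamma>. \<exists>\<mu>\<in>\<Gamma>.
          a \<preceq> e \<cdot>\<mu>\<cdot> a \<and> a \<preceq> a \<cdot>\<rho>\<cdot> e' \<and>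
          strongly_regular_subsemigroup M (downset M (carrier M \<odot> {a} \<odot> carrier M))))
   \<and> (strongly_regular M \<longleftrightarrow>
       (\<forall>a\<in>carrier M.
          a \<in> downset M (carrier M \<odot> {a}) \<inter> downset M ({a} \<odot> carrier M) \<and>
          strongly_regular_subsemigroup M (downset M (carrier M \<odot> {a} \<odot> carrier M))))"
proof -
  interpret ordered_gamma_semigroup M by fact
  let ?sr = "\<lambda>a. strongly_regular_subsemigroup M (downset M (carrier M \<odot> {a} \<odot> carrier M))"
  let ?two = "\<forall>a\<in>carrier M. \<exists>y\<in>carrier M. \<exists>\<gamma>\<in>\<Gamma>. \<exists>\<mu>\<in>\<Gamma>.
          a \<preceq> a \<cdot>\<gamma>\<cdot> y \<cdot>\<mu>\<cdot> a \<and> y \<preceq> y \<cdot>\<mu>\<cdot> a \<cdot>\<gamma>\<cdot> y \<and>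
          a \<cdot>\<gamma>\<cdot> y = y \<cdot>\<gamma>\<cdot> a \<and> y \<cdot>\<gamma>\<cdot> a = y \<cdot>\<mu>\<cdot> a \<and> y \<cdot>\<mu>\<cdot> a = a \<cdot>\<mu>\<cdot> y"
  let ?three = "\<forall>C \<in> carrier M // \<N>. strongly_regular_subsemigroup M C"
  let ?four = "(\<forall>L. left_ideal M L \<longrightarrow> semiprime M L) \<and>
       (\<forall>R. right_ideal M R \<longrightarrow> semiprime M R) \<and>
       (\<forall>L R. left_ideal M L \<and> right_ideal M R \<longrightarrow>
          strongly_regular_subsemigroup M (downset M (L \<odot> R)))"
  let ?five = "left_regular M \<and> right_regular M \<and> (\<forall>a\<in>carrier M. ?sr a)"
  let ?six = "\<forall>a\<in>carrier M.
          \<exists>e \<in> carrier M \<odot> {a} \<odot> {a} \<odot> carrier M.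
          \<exists>e' \<in> carrier M \<odot> {a} \<odot> {a} \<odot> carrier M.
          \<exists>\<rho>\<in>\<Gamma>. \<exists>\<mu>\<in>\<Gamma>.
            e \<preceq> e \<cdot>\<rho>\<cdot> e' \<and> a \<preceq> e \<cdot>\<mu>\<cdot> a \<and> a \<preceq> a \<cdot>\<rho>\<cdot> e' \<and>
            downset M (carrier M \<odot> {e} \<odot> carrier M) = downset M (carrier M \<odot> {e'} \<odot> carrier M) \<and>
            downset M (carrier M \<odot> {e'} \<odot> carrier M) = downset M (carrier M \<odot> {a} \<odot> carrier M) \<and>
            ?sr a"
  let ?seven = "\<forall>a\<in>carrier M. \<exists>e\<in>carrier M. \<exists>e'\<in>carrier M. \<exists>\<rho>\<in>\<Gamma>. \<exists>\<mu>\<in>\<Gamma>.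
          a \<preceq> e \<cdot>\<mu>\<cdot> a \<and> a \<preceq> a \<cdot>\<rho>\<cdot> e' \<and> ?sr a"
  let ?eight = "\<forall>a\<in>carrier M.
          a \<in> downset M (carrier M \<odot> {a}) \<inter> downset M ({a} \<odot> carrier M) \<and> ?sr a"
  \<comment> \<open>The label \<open>ij\<close> marks the step from condition i to condition j.
    Conditions 2 and 3 are tied to 1 directly; the others lie on the cycles 1, 4, 5, 8, 1 and 1, 6,
    7, 8, 1.\<close>
  have 12: ?two if "strongly_regular M"
    using strong_inverse[OF that] by metis
  have 21: "strongly_regular M" if ?two
    using that unfolding strongly_regular_def strongly_regular_on_def by meson
  have 13: ?three if "strongly_regular M"
    using filter_class_subsemigroup filter_class_strongly_regular[OF that]
    unfolding strongly_regular_subsemigroup_def by blast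
  have 14: ?four if "strongly_regular M"
    using that left_ideal_semiprime right_ideal_semiprime ideal_product_strongly_regular by blast
  have 45: ?five if ?four
    using that left_regular_if_semiprime right_regular_if_semiprime
      principal_strongly_regular_if_products by simp
  have 58: ?eight if ?five
    using that left_regular_mem right_regular_mem by blast
  have 16: ?six if "strongly_regular M"
  proof
    fix a assume a: "a \<in> carrier M"
    then show "\<exists>e \<in> carrier M \<odot> {a} \<odot> {a} \<odot> carrier M.
          \<exists>e' \<in> carrier M \<odot> {a} \<odot> {a} \<odot> carrier M.
          \<exists>\<rho>\<in>\<Gamma>. \<exists>\<mu>\<in>\<Gamma>.
            e \<preceq> e \<cdot>\<rho>\<cdot> e' \<and> a \<preceq> e \<cdot>\<mu>\<cdot> a \<and> a \<preceq> a \<cdot>\<rho>\<cdot> e' \<and>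
            downset M (carrier M \<odot> {e} \<odot> carrier M) = downset M (carrier M \<odot> {e'} \<odot> carrier M) \<and>
            downset M (carrier M \<odot> {e'} \<odot> carrier M) = downset M (carrier M \<odot> {a} \<odot> carrier M) \<and>
            ?sr a"
      using two_sided_unit[OF that a] principal_strongly_regular[OF that a] by metis
  qed
  have 67: ?seven if six: ?six
  proof
    fix a assume a: "a \<in> carrier M"
    obtain e e' \<rho> \<mu> where
      "e \<in> carrier M \<odot> {a} \<odot> {a} \<odot> carrier M" "e' \<in> carrier M \<odot> {a} \<odot> {a} \<odot> carrier M"
      "\<rho> \<in> \<Gamma>" "\<mu> \<in> \<Gamma>" "a \<preceq> e \<cdot>\<mu>\<cdot> a" "a \<preceq> a \<cdot>\<rho>\<cdot> e'" "?sr a"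
      using bspec[OF six a] by (elim bexE conjE)
    \<comment> \<open>All that condition 7 retains of the location of \<open>e\<close> and
      \<open>e'\<close> is that they belong to \<open>M\<close>.\<close>
    moreover have "carrier M \<odot> {a} \<odot> {a} \<odot> carrier M \<subseteq> carrier M"
      using a by (intro set_mult_closed) auto
    ultimately show "\<exists>e\<in>carrier M. \<exists>e'\<in>carrier M. \<exists>\<rho>\<in>\<Gamma>. \<exists>\<mu>\<in>\<Gamma>.
        a \<preceq> e \<cdot>\<mu>\<cdot> a \<and> a \<preceq> a \<cdot>\<rho>\<cdot> e' \<and> ?sr a"
      by (meson subsetD)
  qed
  have 78: ?eight if seven: ?seven
  proof
    fix a assume a: "a \<in> carrier M"
    obtain e e' \<rho> \<mu> where "e \<in> carrier M" "e' \<in> carrier M" "\<rho> \<in> \<Gamma>" "\<mu> \<in> \<Gamma>"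
      "a \<preceq> e \<cdot>\<mu>\<cdot> a" "a \<preceq> a \<cdot>\<rho>\<cdot> e'" "?sr a"
      using bspec[OF seven a] by (elim bexE conjE)
    then show "a \<in> downset M (carrier M \<odot> {a}) \<inter> downset M ({a} \<odot> carrier M) \<and> ?sr a"
      using a by (auto intro: downsetI)
  qed
  have 81: "strongly_regular M" if ?eight
    using strongly_regular_if_principal that by blast
  show ?thesis
  proof (intro conjI)
    show "strongly_regular M \<longleftrightarrow> ?two" using 12 21 by (rule iffI)
    show "strongly_regular M \<longleftrightarrow> ?three" using 13 strongly_regular_if_filter_classes by (rule iffI)
    show "strongly_regular M \<longleftrightarrow> ?four" using 14 81[OF 58[OF 45]] by (rule iffI)
    show "strongly_regular M \<longleftrightarrow> ?five" using 45[OF 14] 81[OF 58] by (rule iffI)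
    show "strongly_regular M \<longleftrightarrow> ?six" using 16 81[OF 78[OF 67]] by (rule iffI)
    show "strongly_regular M \<longleftrightarrow> ?seven" using 67[OF 16] 81[OF 78] by (rule iffI)
    show "strongly_regular M \<longleftrightarrow> ?eight" using 78[OF 67[OF 16]] 81 by (rule iffI)
  qed
qed

end
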